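(* Let $\Phi_r$ be a time reparameterization of the flow $\Phi$ with associated function $r$. For any $\mu\in\mathcal{M}(\Phi)$ and the measure $\widehat\mu_r$ defined by $d\widehat\mu_r=r\,d\mu$ on $\widehat M$, we have $$\underline d_{\widehat\mu_r}(x)=\underline d_\mu(x)\quad\text{and}\quad \overline d_{\widehat\mu_r}(x)=\overline d_\mu(x)\qquad\text{for all }x\in\widehat M .$$ Moreover, if $r\in L^1(M,\mu)$ and $\mu_r$ is the probability measure given by $d\mu_r=\frac{r}{\int_M r\,d\mu}\,d\mu$, then $\dim_{\rm H}\mu_r\le\dim_{\rm H}\mu$.
   Context: Setting. $M$ is a manifold of class $C^m$, $m\ge 2$, with a Riemannian metric of class $C^{m-1}$ and induced distance $\rho$. $f$ is a $C^\ell$ vector field on $M$, $1\le \ell<m$, such that $dx/dt=f(x)$ generates a $C^\ell$ flow $\Phi=\{\varphi^t\}_{t\in\mathbb{R}}$. A $C^\ell$ flow $\Phi_r=\{\varphi^\tau_r\}_{\tau\in\mathbb{R}}$ on $M$ is a time reparameterization of $\Phi$ if for every $x$ the orbits of $x$ under both flows coincide and have the same orientation. Its associated function $r\ge0$ is positive and of class $C^{\ell-1}$ at every non-fixed point, where $\varphi_r^\tau(x)=\varphi^{t(x,\tau)}(x)$ and $r(x)=\big(\frac{\partial}{\partial\tau}t(x,\tau)|_{\tau=0}\big)^{-1}$ (so $d\tau=r(x)\,dt$). $\widehat M=\{x\in M:f(x)\ne0\}$, except that $\widehat M=M$ if $r$ is positive and of class $C^{\ell-1}$ on all of $M$. $\mathcal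 M(\Phi)$ is the set of $\Phi$-invariant Borel probability measures on $M$. When $\mu_r$ is considered, $\int_M r\,d\mu>0$ is understood. Dimensions. For a $\sigma$-finite Borel measure $\nu$ and $B(x,\varepsilon)=\{z:\rho(x,z)<\varepsilon\}$, $$\underline d_\nu(x)=\liminf_{\varepsilon\to0}\frac{\log\nu(B(x,\varepsilon))}{\log\varepsilon},\qquad\overline d_\nu(x)=\limsup_{\varepsilon\to0}\frac{\log\nu(B(x,\varepsilon))}{\log\varepsilon}.$$ For a Borel probability measure $\nu$, $\dim_{\rm H}\nu=\inf\{\dim_{\rm H}A: A\subset M,\ \nu(A)=1\}$, where $\dim_{\rm H}A$ is the Hausdorff dimension of $A$. *)

theory Defs
  imports "HOL-Probability.Probability"
begin

text \<open>Only meant for open \<open>S\<close>: derivatives are taken with respect to the full space.\<close>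

primrec Ck_on :: "nat \<Rightarrow> 'a::real_normed_vector set \<Rightarrow> ('a \<Rightarrow> 'b::real_normed_vector) \<Rightarrow> bool" where
  "Ck_on 0 S h \<longleftrightarrow> continuous_on S h"
| "Ck_on (Suc k) S h \<longleftrightarrow>
     (\<forall>x\<in>S. h differentiable (at x)) \<and> (\<forall>v. Ck_on k S (\<lambda>x. frechet_derivative h (at x) v))"

text \<open>A chart is a pair of an open set of the manifold and a coordinate map, whose values outside
  that set are irrelevant. The manifold is the whole type \<open>'a\<close>; it is modelled on \<open>'e\<close>.\<close>

type_synonym ('a, 'e) chart = "'a set \<times> ('a \<Rightarrow> 'e)"

abbreviation chart_dom :: "('a, 'e) chart \<Rightarrow> 'a set" where
  "chart_dom c \<equiv> fst c"

abbreviation coord :: "('a, 'e) chart \<Rightarrow> 'a \<Rightarrow> 'e" where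
  "coord c \<equiv> snd c"

abbreviation chart_inv :: "('a, 'e) chart \<Rightarrow> 'e \<Rightarrow> 'a" where
  "chart_inv c \<equiv> inv_into (chart_dom c) (coord c)"

definition Ck_atlas :: "nat \<Rightarrow> ('a::topological_space, 'e::euclidean_space) chart set \<Rightarrow> bool" where
  "Ck_atlas m \<A> \<longleftrightarrow>
     (\<Union>c\<in>\<A>. chart_dom c) = UNIV \<and>
     (\<forall>c\<in>\<A>. open (chart_dom c) \<and> open (coord c ` chart_dom c) \<and>
        homeomorphism (chart_dom c) (coord c ` chart_dom c) (coord c) (chart_inv c)) \<and>
     (\<forall>c\<in>\<A>. \<forall>d\<in>\<A>. Ck_on m (coord c ` (chart_dom c \<inter> chart_dom d)) (coord d \<circ> chart_inv c))"

text \<open>The differential at \<open>x\<close> of the change of coordinates from \<open>c\<close> to \<open>d\<close>.\<close>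

definition transition_deriv ::
  "('a, 'e::euclidean_space) chart \<Rightarrow> ('a, 'e) chart \<Rightarrow> 'a \<Rightarrow> 'e \<Rightarrow> 'e" where
  "transition_deriv c d x = frechet_derivative (coord d \<circ> chart_inv c) (at (coord c x))"

definition Ck_function_on ::
  "nat \<Rightarrow> ('a, 'e::euclidean_space) chart set \<Rightarrow> 'a set \<Rightarrow> ('a \<Rightarrow> real) \<Rightarrow> bool" where
  "Ck_function_on k \<A> W h \<longleftrightarrow>
     (\<forall>c\<in>\<A>. Ck_on k (coord c ` (chart_dom c \<inter> W)) (h \<circ> chart_inv c))"

text \<open>Tensor fields are given by their components: \<open>f c x\<close> is the coordinate vector of the tangent
  vector at \<open>x\<close> in the chart \<open>c\<close>, and \<open>g c x v w\<close> is the value of the metric on the tangent vectors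
  at \<open>x\<close> with coordinate vectors \<open>v\<close> and \<open>w\<close>. Values at points outside the chart are irrelevant.\<close>

definition Ck_vector_field ::
  "nat \<Rightarrow> ('a, 'e::euclidean_space) chart set \<Rightarrow> (('a, 'e) chart \<Rightarrow> 'a \<Rightarrow> 'e) \<Rightarrow> bool" where
  "Ck_vector_field k \<A> f \<longleftrightarrow>
     (\<forall>c\<in>\<A>. \<forall>d\<in>\<A>. \<forall>x\<in>chart_dom c \<inter> chart_dom d. f d x = transition_deriv c d x (f c x)) \<and>
     (\<forall>c\<in>\<A>. Ck_on k (coord c ` chart_dom c) (f c \<circ> chart_inv c))"

definition vanishes_at ::
  "('a, 'e::euclidean_space) chart set \<Rightarrow> (('a, 'e) chart \<Rightarrow> 'a \<Rightarrow> 'e) \<Rightarrow> 'a \<Rightarrow> bool" where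
  "vanishes_at \<A> f x \<longleftrightarrow> (\<forall>c\<in>\<A>. x \<in> chart_dom c \<longrightarrow> f c x = 0)"

definition Ck_riemannian_metric ::
  "nat \<Rightarrow> ('a, 'e::euclidean_space) chart set \<Rightarrow> (('a, 'e) chart \<Rightarrow> 'a \<Rightarrow> 'e \<Rightarrow> 'e \<Rightarrow> real) \<Rightarrow> bool" where
  "Ck_riemannian_metric k \<A> g \<longleftrightarrow>
     (\<forall>c\<in>\<A>. \<forall>x\<in>chart_dom c.
        bilinear (g c x) \<and> (\<forall>v w. g c x v w = g c x w v) \<and> (\<forall>v. v \<noteq> 0 \<longrightarrow> 0 < g c x v v)) \<and>
     (\<forall>c\<in>\<A>. \<forall>d\<in>\<A>. \<forall>x\<in>chart_dom c \<inter> chart_dom d. \<forall>v w.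
        g c x v w = g d x (transition_deriv c d x v) (transition_deriv c d x w)) \<and>
     (\<forall>c\<in>\<A>. \<forall>v w. Ck_on k (coord c ` chart_dom c) (\<lambda>y. g c (chart_inv c y) v w))"

definition C1_curve_on ::
  "('a::topological_space, 'e::euclidean_space) chart set \<Rightarrow> real \<Rightarrow> real \<Rightarrow> (real \<Rightarrow> 'a) \<Rightarrow> bool" where
  "C1_curve_on \<A> a b \<gamma> \<longleftrightarrow>
     continuous_on {a..b} \<gamma> \<and>
     (\<forall>c\<in>\<A>. \<exists>D. continuous_on {t\<in>{a..b}. \<gamma> t \<in> chart_dom c} D \<and>
        (\<forall>t\<in>{a..b}. \<gamma> t \<in> chart_dom c \<longrightarrow>
           ((coord c \<circ> \<gamma>) has_vector_derivative D t) (at t within {a..b})))"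

definition piecewise_C1_curve ::
  "('a::topological_space, 'e::euclidean_space) chart set \<Rightarrow> (real \<Rightarrow> 'a) \<Rightarrow> bool" where
  "piecewise_C1_curve \<A> \<gamma> \<longleftrightarrow>
     (\<exists>(n::nat) (p::nat \<Rightarrow> real). p 0 = 0 \<and> p n = 1 \<and>
        (\<forall>i<n. p i < p (Suc i) \<and> C1_curve_on \<A> (p i) (p (Suc i)) \<gamma>))"

text \<open>By the transformation law of the metric the speed does not depend on the selected chart.
  Its junk values at the break points of the curve do not affect the length.\<close>

definition curve_speed ::
  "('a, 'e::euclidean_space) chart set \<Rightarrow> (('a, 'e) chart \<Rightarrow> 'a \<Rightarrow> 'e \<Rightarrow> 'e \<Rightarrow> real) \<Rightarrow>
   (real \<Rightarrow> 'a) \<Rightarrow> real \<Rightarrow> real" where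
  "curve_speed \<A> g \<gamma> t =
     (let c = (SOME c. c \<in> \<A> \<and> \<gamma> t \<in> chart_dom c);
          v = vector_derivative (coord c \<circ> \<gamma>) (at t within {0..1})
      in sqrt (g c (\<gamma> t) v v))"

definition curve_length ::
  "('a, 'e::euclidean_space) chart set \<Rightarrow> (('a, 'e) chart \<Rightarrow> 'a \<Rightarrow> 'e \<Rightarrow> 'e \<Rightarrow> real) \<Rightarrow>
   (real \<Rightarrow> 'a) \<Rightarrow> ennreal" where
  "curve_length \<A> g \<gamma> = (\<integral>\<^sup>+t\<in>{0..1}. ennreal (curve_speed \<A> g \<gamma> t) \<partial>lborel)"

text \<open>The distance is \<open>\<infinity>\<close> between points in different connected components.\<close>

definition riemannian_dist ::
  "('a::topological_space, 'e::euclidean_space) chart set \<Rightarrow>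
   (('a, 'e) chart \<Rightarrow> 'a \<Rightarrow> 'e \<Rightarrow> 'e \<Rightarrow> real) \<Rightarrow> 'a \<Rightarrow> 'a \<Rightarrow> ennreal" where
  "riemannian_dist \<A> g x y =
     Inf {curve_length \<A> g \<gamma> |\<gamma>. piecewise_C1_curve \<A> \<gamma> \<and> \<gamma> 0 = x \<and> \<gamma> 1 = y}"

definition Ck_flow ::
  "nat \<Rightarrow> ('a::topological_space, 'e::euclidean_space) chart set \<Rightarrow> (real \<Rightarrow> 'a \<Rightarrow> 'a) \<Rightarrow> bool" where
  "Ck_flow k \<A> \<Phi> \<longleftrightarrow>
     (\<forall>x. \<Phi> 0 x = x) \<and> (\<forall>s t x. \<Phi> (s + t) x = \<Phi> s (\<Phi> t x)) \<and>
     continuous_on UNIV (\<lambda>(t, x). \<Phi> t x) \<and>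
     (\<forall>c\<in>\<A>. \<forall>d\<in>\<A>.
        Ck_on k {(t, y). y \<in> coord c ` chart_dom c \<and> \<Phi> t (chart_inv c y) \<in> chart_dom d}
          (\<lambda>(t, y). coord d (\<Phi> t (chart_inv c y))))"

definition generates_flow ::
  "('a, 'e::euclidean_space) chart set \<Rightarrow> (('a, 'e) chart \<Rightarrow> 'a \<Rightarrow> 'e) \<Rightarrow>
   (real \<Rightarrow> 'a \<Rightarrow> 'a) \<Rightarrow> bool" where
  "generates_flow \<A> f \<Phi> \<longleftrightarrow>
     (\<forall>c\<in>\<A>. \<forall>t x. \<Phi> t x \<in> chart_dom c \<longrightarrow>
        ((\<lambda>s. coord c (\<Phi> s x)) has_vector_derivative f c (\<Phi> t x)) (at t))"

text \<open>\<open>T\<close> is the function \<open>\<tau> \<mapsto> t(x,\<tau>)\<close> for the point \<open>x\<close>. Continuity and \<open>T 0 = 0\<close> make it unique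
  at every non-fixed point, periodic points included; monotonicity expresses that the two orbits
  have the same orientation.\<close>

definition time_change ::
  "(real \<Rightarrow> 'a \<Rightarrow> 'a) \<Rightarrow> (real \<Rightarrow> 'a \<Rightarrow> 'a) \<Rightarrow> 'a \<Rightarrow> (real \<Rightarrow> real) \<Rightarrow> bool" where
  "time_change \<Phi> \<Phi>r x T \<longleftrightarrow>
     T 0 = 0 \<and> continuous_on UNIV T \<and> strict_mono T \<and> (\<forall>\<tau>. \<Phi>r \<tau> x = \<Phi> (T \<tau>) x)"

definition time_reparameterization ::
  "nat \<Rightarrow> ('a::topological_space, 'e::euclidean_space) chart set \<Rightarrow>
   (real \<Rightarrow> 'a \<Rightarrow> 'a) \<Rightarrow> (real \<Rightarrow> 'a \<Rightarrow> 'a) \<Rightarrow> bool" where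
  "time_reparameterization l \<A> \<Phi> \<Phi>r \<longleftrightarrow>
     Ck_flow l \<A> \<Phi>r \<and>
     (\<forall>x. range (\<lambda>\<tau>. \<Phi>r \<tau> x) = range (\<lambda>t. \<Phi> t x) \<and> (\<exists>T. time_change \<Phi> \<Phi>r x T))"

definition nonfixed_points :: "(real \<Rightarrow> 'a \<Rightarrow> 'a) \<Rightarrow> 'a set" where
  "nonfixed_points \<Phi> = {x. \<exists>t. \<Phi> t x \<noteq> x}"

text \<open>At the fixed points the function is an arbitrary non-negative number.\<close>

definition associated_function ::
  "nat \<Rightarrow> ('a, 'e::euclidean_space) chart set \<Rightarrow>
   (real \<Rightarrow> 'a \<Rightarrow> 'a) \<Rightarrow> (real \<Rightarrow> 'a \<Rightarrow> 'a) \<Rightarrow> ('a \<Rightarrow> real) \<Rightarrow> bool" where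
  "associated_function l \<A> \<Phi> \<Phi>r r \<longleftrightarrow>
     (\<forall>x. 0 \<le> r x) \<and>
     (\<forall>x\<in>nonfixed_points \<Phi>. 0 < r x \<and>
        (\<exists>T D. time_change \<Phi> \<Phi>r x T \<and> (T has_real_derivative D) (at 0) \<and> r x = inverse D)) \<and>
     Ck_function_on (l - 1) \<A> (nonfixed_points \<Phi>) r"

definition M_hat ::
  "nat \<Rightarrow> ('a, 'e::euclidean_space) chart set \<Rightarrow> (('a, 'e) chart \<Rightarrow> 'a \<Rightarrow> 'e) \<Rightarrow>
   ('a \<Rightarrow> real) \<Rightarrow> 'a set" where
  "M_hat l \<A> f r =
     (if (\<forall>x. 0 < r x) \<and> Ck_function_on (l - 1) \<A> UNIV r then UNIV else {x. \<not> vanishes_at \<A> f x})"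

definition invariant_measures :: "(real \<Rightarrow> 'a::topological_space \<Rightarrow> 'a) \<Rightarrow> 'a measure set" where
  "invariant_measures \<Phi> =
     {\<mu>. sets \<mu> = sets borel \<and> prob_space \<mu> \<and> (\<forall>t. distr \<mu> borel (\<Phi> t) = \<mu>)}"

text \<open>The measure \<open>r d\<mu>\<close> on \<open>M_hat\<close>, regarded as a Borel measure on the whole manifold.\<close>

definition mu_hat :: "'a set \<Rightarrow> ('a \<Rightarrow> real) \<Rightarrow> 'a measure \<Rightarrow> 'a measure" where
  "mu_hat W r \<mu> = density \<mu> (\<lambda>x. ennreal (r x) * indicator W x)"

definition mu_rep :: "('a \<Rightarrow> real) \<Rightarrow> 'a measure \<Rightarrow> 'a measure" where
  "mu_rep r \<mu> = density \<mu> (\<lambda>x. ennreal (r x / (LINT y|\<mu>. r y)))"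

text \<open>All notions are relative to an explicit extended distance \<open>\<rho>\<close>.\<close>

definition dist_ball :: "('a \<Rightarrow> 'a \<Rightarrow> ennreal) \<Rightarrow> 'a \<Rightarrow> real \<Rightarrow> 'a set" where
  "dist_ball \<rho> x \<epsilon> = {z. \<rho> x z < ennreal \<epsilon>}"

text \<open>With \<open>log 0 = -\<infinity>\<close>, the pointwise dimensions are \<open>\<infinity>\<close> outside the support of the measure.\<close>

definition ext_ln :: "ennreal \<Rightarrow> ereal" where
  "ext_ln a = (if a = 0 then -\<infinity> else if a = \<infinity> then \<infinity> else ereal (ln (enn2real a)))"

definition lower_pointwise_dim :: "('a \<Rightarrow> 'a \<Rightarrow> ennreal) \<Rightarrow> 'a measure \<Rightarrow> 'a \<Rightarrow> ereal" where
  "lower_pointwise_dim \<rho> \<nu> x =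
     Liminf (at_right 0) (\<lambda>\<epsilon>::real. ext_ln (emeasure \<nu> (dist_ball \<rho> x \<epsilon>)) / ereal (ln \<epsilon>))"

definition upper_pointwise_dim :: "('a \<Rightarrow> 'a \<Rightarrow> ennreal) \<Rightarrow> 'a measure \<Rightarrow> 'a \<Rightarrow> ereal" where
  "upper_pointwise_dim \<rho> \<nu> x =
     Limsup (at_right 0) (\<lambda>\<epsilon>::real. ext_ln (emeasure \<nu> (dist_ball \<rho> x \<epsilon>)) / ereal (ln \<epsilon>))"

definition ext_diam :: "('a \<Rightarrow> 'a \<Rightarrow> ennreal) \<Rightarrow> 'a set \<Rightarrow> ennreal" where
  "ext_diam \<rho> U = (SUP x\<in>U. SUP y\<in>U. \<rho> x y)"

text \<open>The \<open>s\<close>-th power of a finite diameter; \<open>powr\<close> has \<open>0 powr 0 = 0\<close>, whereas the zeroth power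
  has to be 1 for every nonempty set. The empty set always contributes 0.\<close>

definition diam_pow :: "('a \<Rightarrow> 'a \<Rightarrow> ennreal) \<Rightarrow> real \<Rightarrow> 'a set \<Rightarrow> ennreal" where
  "diam_pow \<rho> s U =
     (if U = {} then 0 else if s = 0 then 1 else ennreal (enn2real (ext_diam \<rho> U) powr s))"

definition hausdorff_premeasure ::
  "('a \<Rightarrow> 'a \<Rightarrow> ennreal) \<Rightarrow> real \<Rightarrow> real \<Rightarrow> 'a set \<Rightarrow> ennreal" where
  "hausdorff_premeasure \<rho> s \<delta> A =
     Inf {(\<Sum>i. diam_pow \<rho> s (U i)) |U :: nat \<Rightarrow> 'a set.
            A \<subseteq> (\<Union>i. U i) \<and> (\<forall>i. ext_diam \<rho> (U i) \<le> ennreal \<delta>)}"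

definition hausdorff_measure :: "('a \<Rightarrow> 'a \<Rightarrow> ennreal) \<Rightarrow> real \<Rightarrow> 'a set \<Rightarrow> ennreal" where
  "hausdorff_measure \<rho> s A = (SUP \<delta>\<in>{0<..}. hausdorff_premeasure \<rho> s \<delta> A)"

definition hausdorff_dim :: "('a \<Rightarrow> 'a \<Rightarrow> ennreal) \<Rightarrow> 'a set \<Rightarrow> ennreal" where
  "hausdorff_dim \<rho> A = Inf {ennreal s |s. 0 \<le> s \<and> hausdorff_measure \<rho> s A = 0}"

definition measure_hausdorff_dim :: "('a \<Rightarrow> 'a \<Rightarrow> ennreal) \<Rightarrow> 'a measure \<Rightarrow> ennreal" where
  "measure_hausdorff_dim \<rho> \<nu> = Inf {hausdorff_dim \<rho> A |A. A \<in> sets \<nu> \<and> emeasure \<nu> A = 1}"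

end

theory Submission
  imports Defs
begin

text \<open>Around a point \<open>x\<close> of \<open>M_hat\<close> the density \<open>r\<close> is continuous and positive, hence bounded and bounded
  away from zero on a neighbourhood \<open>V\<close> of \<open>x\<close> (\<open>M_hat_properties\<close>). On subsets of \<open>V\<close> the measures \<open>\<mu>\<close>
  and \<open>r d\<mu>\<close> then agree up to constant factors (\<open>mu_hat_locally_comparable\<close>), and a constant factor in
  the measure of a ball does not affect pointwise dimensions, because its logarithm is divided by
  \<open>log \<epsilon> \<rightarrow> -\<infinity>\<close> (\<open>pointwise_dim_antimono\<close>).

  What makes this argument apply is that the balls of the Riemannian distance around \<open>x\<close> eventually lie
  in \<open>V\<close> (\<open>small_dist_ball_subset\<close>). The distance is an infimum of lengths of piecewise \<open>C\<^sup>1\<close> curves, so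
  this amounts to a positive lower bound for the length of all curves that start at \<open>x\<close> and leave
  \<open>V\<close>. On a compact coordinate ball the metric dominates a multiple of the euclidean one
  (\<open>riemannian_metric_lower_bound\<close>), so the length of a curve is at least that multiple of the euclidean
  distance that it covers in the chart (\<open>curve_length_ge_in_chart\<close>).

  The inequality of Hausdorff dimensions follows from the absolute continuity of \<open>\<mu>\<^sub>r\<close> with
  respect to \<open>\<mu>\<close> (\<open>measure_hausdorff_dim_mu_rep_le\<close>).\<close>

section \<open>Comparing pointwise dimensions\<close>

text \<open>The error \<open>e\<close> absorbs the term \<open>ln b / ln \<epsilon>\<close>. If one of the measures is degenerate, the quotients
  are infinite with the right sign, since \<open>ln \<epsilon> < 0\<close>.\<close>

lemma ext_ln_quotient_le:
  assumes "v \<le> ennreal b * u" "0 < b" "0 < \<epsilon>" "\<epsilon> < 1" "\<bar>ln b / ln \<epsilon>\<bar> \<le> e"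
  shows "ext_ln u / ereal (ln \<epsilon>) \<le> ext_ln v / ereal (ln \<epsilon>) + ereal e"
proof -
  have neg: "ln \<epsilon> < 0"
    using assms by simp
  consider "v = 0" | "u = \<infinity>" | "v \<noteq> 0" "u \<noteq> \<infinity>" by blast
  then show ?thesis
  proof cases
    case 1
    then show ?thesis using neg by (simp add: ext_ln_def)
  next
    case 2
    then show ?thesis using neg by (simp add: ext_ln_def)
  next
    case 3
    then obtain y where y: "u = ennreal y" "0 \<le> y"
      by (cases u) auto
    have vfin: "v \<le> ennreal (b * y)"
      using assms y by (simp add: ennreal_mult)
    then obtain z where z: "v = ennreal z" "0 \<le> z"
      by (cases v) (auto simp: top_unique)
    have "z \<le> b * y"
      using vfin z y assms by (simp add: ennreal_le_iff)
    moreover have "0 < z"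
      using z 3 by (auto simp: less_le)
    ultimately have pos: "0 < y" "0 < z" and le: "z \<le> b * y"
      using assms(2) zero_less_mult_pos[of b y] by auto
    have "ln z \<le> ln b + ln y"
      using le pos assms(2) ln_mult[of b y] ln_le_cancel_iff[of z "b * y"] by simp
    then have "(ln b + ln y) / ln \<epsilon> \<le> ln z / ln \<epsilon>"
      using neg by (intro divide_right_mono_neg) auto
    then have "ln y / ln \<epsilon> \<le> ln z / ln \<epsilon> + e"
      using assms(5) unfolding add_divide_distrib by linarith
    then show ?thesis
      using y z pos neg by (simp add: ext_ln_def del: ereal_divide) (simp add: ereal_divide_eq)
  qed
qed

text \<open>A constant factor changes \<open>log \<nu>(B(x, \<epsilon>))\<close> by a bounded amount, which disappears after
  division by \<open>log \<epsilon> \<rightarrow> -\<infinity>\<close>; the sign of \<open>log \<epsilon>\<close> turns the upper bound for the measure into a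
  lower bound for its dimensions.\<close>

lemma pointwise_dim_antimono:
  assumes "0 < b"
    and "\<forall>\<^sub>F \<epsilon> in at_right 0. emeasure \<nu> (dist_ball \<rho> x \<epsilon>) \<le> ennreal b * emeasure \<mu> (dist_ball \<rho> x \<epsilon>)"
  shows "lower_pointwise_dim \<rho> \<mu> x \<le> lower_pointwise_dim \<rho> \<nu> x"
    and "upper_pointwise_dim \<rho> \<mu> x \<le> upper_pointwise_dim \<rho> \<nu> x"
proof -
  define q where "q \<kappa> \<epsilon> = ext_ln (emeasure \<kappa> (dist_ball \<rho> x \<epsilon>)) / ereal (ln \<epsilon>)"
    for \<kappa> :: "'a measure" and \<epsilon> :: real
  have ev: "\<forall>\<^sub>F \<epsilon> in at_right 0. q \<mu> \<epsilon> \<le> q \<nu> \<epsilon> + ereal e" if "0 < e" for e :: real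
  proof -
    have "((\<lambda>\<epsilon>::real. ln b / ln \<epsilon>) \<longlongrightarrow> 0) (at_right 0)"
      using ln_at_0 by (intro tendsto_divide_0[OF tendsto_const] filterlim_at_bot_imp_at_infinity)
    then have "\<forall>\<^sub>F \<epsilon> in at_right 0. \<bar>ln b / ln \<epsilon>\<bar> < e"
      using that by (auto dest!: tendstoD[where e = e] simp: dist_real_def)
    moreover have "\<forall>\<^sub>F \<epsilon>::real in at_right 0. 0 < \<epsilon> \<and> \<epsilon> < 1"
      using eventually_at_right_real[of 0 1] by simp
    ultimately show ?thesis
      using assms(2)
    proof eventually_elim
      case (elim \<epsilon>)
      then show ?case
        unfolding q_def using \<open>0 < b\<close> by (intro ext_ln_quotient_le[where b = b]) auto
    qed
  qed
  have "Liminf (at_right 0) (q \<mu>) \<le> Liminf (at_right 0) (q \<nu>) + ereal e"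
    and "Limsup (at_right 0) (q \<mu>) \<le> Limsup (at_right 0) (q \<nu>) + ereal e" if "0 < e" for e :: real
    using Liminf_mono[OF ev[OF that]] Limsup_mono[OF ev[OF that]]
    by (simp_all add: Liminf_add_ereal_right Limsup_add_ereal_right)
  then show "lower_pointwise_dim \<rho> \<mu> x \<le> lower_pointwise_dim \<rho> \<nu> x"
    and "upper_pointwise_dim \<rho> \<mu> x \<le> upper_pointwise_dim \<rho> \<nu> x"
    unfolding lower_pointwise_dim_def upper_pointwise_dim_def q_def[symmetric]
    by (auto intro: ereal_le_epsilon2)
qed

section \<open>Continuity in charts\<close>

lemma Ck_on_imp_continuous_on: "Ck_on k S h \<Longrightarrow> continuous_on S h"
proof (cases k)
  case (Suc k')
  moreover assume "Ck_on k S h"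
  ultimately have "h differentiable_on S"
    by (simp add: differentiable_at_imp_differentiable_on)
  then show ?thesis
    by (rule differentiable_imp_continuous_on)
qed simp

lemma atlas_chart:
  assumes "Ck_atlas m \<A>" "c \<in> \<A>"
  shows "open (chart_dom c)" "open (coord c ` chart_dom c)"
    "homeomorphism (chart_dom c) (coord c ` chart_dom c) (coord c) (chart_inv c)"
  using assms by (auto simp: Ck_atlas_def)

lemma atlas_cover:
  assumes "Ck_atlas m \<A>"
  obtains c where "c \<in> \<A>" "x \<in> chart_dom c"
proof -
  have "x \<in> (\<Union>c\<in>\<A>. chart_dom c)"
    using assms by (simp add: Ck_atlas_def)
  then show thesis
    using that by blast
qed

lemma chart_inv_coord:
  assumes "Ck_atlas m \<A>" "c \<in> \<A>" "x \<in> chart_dom c"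
  shows "chart_inv c (coord c x) = x"
  using atlas_chart(3)[OF assms(1,2)] assms(3) by (simp add: homeomorphism_def)

lemma continuous_on_if_continuous_in_chart:
  assumes "Ck_atlas m \<A>" "c \<in> \<A>" "V \<subseteq> chart_dom c" "continuous_on (coord c ` V) (h \<circ> chart_inv c)"
  shows "continuous_on V h"
proof -
  have "continuous_on V (coord c)"
    using atlas_chart(3)[OF assms(1,2)] assms(3) by (auto simp: homeomorphism_def intro: continuous_on_subset)
  then have "continuous_on V ((h \<circ> chart_inv c) \<circ> coord c)"
    using assms(4) by (rule continuous_on_compose)
  moreover have "((h \<circ> chart_inv c) \<circ> coord c) x = h x" if "x \<in> V" for x
    using chart_inv_coord[OF assms(1,2)] assms(3) that by auto
  ultimately show ?thesis
    by (simp cong: continuous_on_cong)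
qed

lemma Ck_function_on_imp_continuous_on:
  assumes "Ck_atlas m \<A>" "Ck_function_on k \<A> W h" "open W"
  shows "continuous_on W h"
proof -
  have "continuous_on (chart_dom c \<inter> W) h" if "c \<in> \<A>" for c
  proof (rule continuous_on_if_continuous_in_chart[OF assms(1) that])
    show "continuous_on (coord c ` (chart_dom c \<inter> W)) (h \<circ> chart_inv c)"
      using assms(2) that unfolding Ck_function_on_def by (blast intro: Ck_on_imp_continuous_on)
  qed simp
  then have "continuous_on (\<Union>c\<in>\<A>. chart_dom c \<inter> W) h"
    using assms(3) atlas_chart(1)[OF assms(1)] by (intro continuous_on_open_UN) auto
  moreover have "(\<Union>c\<in>\<A>. chart_dom c \<inter> W) = W"
    using atlas_cover[OF assms(1)] by auto
  ultimately show ?thesis by simp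
qed

lemma open_nonvanishing:
  assumes "Ck_atlas m \<A>" "Ck_vector_field l \<A> f"
  shows "open {x. \<not> vanishes_at \<A> f x}"
proof -
  have "open {x \<in> chart_dom c. f c x \<noteq> 0}" if "c \<in> \<A>" for c
  proof -
    have "continuous_on (chart_dom c) (f c)"
    proof (rule continuous_on_if_continuous_in_chart[OF assms(1) that order_refl])
      show "continuous_on (coord c ` chart_dom c) (f c \<circ> chart_inv c)"
        using assms(2) that unfolding Ck_vector_field_def by (blast intro: Ck_on_imp_continuous_on)
    qed
    then have "open (f c -` (- {0}) \<inter> chart_dom c)"
      using atlas_chart(1)[OF assms(1) that] continuous_on_open_vimage by blast
    then show ?thesis
      by (simp add: vimage_def Int_def conj_commute)
  qed
  then have "open (\<Union>c\<in>\<A>. {x \<in> chart_dom c. f c x \<noteq> 0})"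
    by auto
  also have "(\<Union>c\<in>\<A>. {x \<in> chart_dom c. f c x \<noteq> 0}) = {x. \<not> vanishes_at \<A> f x}"
    by (auto simp: vanishes_at_def)
  finally show ?thesis .
qed

lemma nonvanishing_imp_nonfixed:
  assumes "generates_flow \<A> f \<Phi>" "\<not> vanishes_at \<A> f x"
  shows "x \<in> nonfixed_points \<Phi>"
proof (rule ccontr)
  assume "x \<notin> nonfixed_points \<Phi>"
  then have fixed: "\<Phi> t x = x" for t
    by (auto simp: nonfixed_points_def)
  obtain c where c: "c \<in> \<A>" "x \<in> chart_dom c" "f c x \<noteq> 0"
    using assms(2) by (auto simp: vanishes_at_def)
  then have "((\<lambda>s. coord c (\<Phi> s x)) has_vector_derivative f c (\<Phi> 0 x)) (at 0)"
    using assms(1) fixed unfolding generates_flow_def by metis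
  then have "((\<lambda>s. coord c x) has_vector_derivative f c x) (at (0::real))"
    by (simp add: fixed)
  then have "f c x = 0"
    using vector_derivative_at has_vector_derivative_const by metis
  with c show False by simp
qed

lemma open_nonfixed_points:
  fixes \<Phi> :: "real \<Rightarrow> 'a::t2_space \<Rightarrow> 'a"
  assumes "Ck_flow l \<A> \<Phi>"
  shows "open (nonfixed_points \<Phi>)"
proof -
  have "continuous_on UNIV (\<Phi> t)" for t
  proof -
    have "continuous_on UNIV (case_prod \<Phi>)"
      using assms by (simp add: Ck_flow_def)
    then have "continuous_on UNIV (\<lambda>x. case_prod \<Phi> (t, x))"
      by (rule continuous_on_compose2) (simp_all add: continuous_on_Pair)
    then show ?thesis by simp
  qed
  then have "open (\<Union>t. {x. \<Phi> t x \<noteq> x})"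
    by (intro open_UN ballI open_Collect_neq) (auto intro: continuous_on_id)
  then show ?thesis
    by (simp add: nonfixed_points_def Collect_ex_eq)
qed

text \<open>Regularity and positivity of \<open>r\<close> are assumed at the points that the flow moves. Every point where
  the field does not vanish is one of these, and such points form an open set.\<close>

lemma M_hat_properties:
  fixes \<A> :: "('a::t2_space, 'e::euclidean_space) chart set"
  assumes "Ck_atlas m \<A>" "Ck_vector_field l \<A> f" "Ck_flow l \<A> \<Phi>" "generates_flow \<A> f \<Phi>"
    and "associated_function l \<A> \<Phi> \<Phi>r r"
  shows "open (M_hat l \<A> f r)" "continuous_on (M_hat l \<A> f r) r" "x \<in> M_hat l \<A> f r \<Longrightarrow> 0 < r x"
proof -
  have sub: "{x. \<not> vanishes_at \<A> f x} \<subseteq> nonfixed_points \<Phi>"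
    using nonvanishing_imp_nonfixed[OF assms(4)] by blast
  have "continuous_on (nonfixed_points \<Phi>) r"
    using assms open_nonfixed_points[OF assms(3)]
    by (intro Ck_function_on_imp_continuous_on[of m \<A> "l - 1"]) (auto simp: associated_function_def)
  then show "open (M_hat l \<A> f r)" "continuous_on (M_hat l \<A> f r) r" "x \<in> M_hat l \<A> f r \<Longrightarrow> 0 < r x"
    using sub open_nonvanishing[OF assms(1,2)] assms(5) Ck_function_on_imp_continuous_on[OF assms(1)]
    by (auto simp: M_hat_def associated_function_def intro: continuous_on_subset split: if_splits)
qed

section \<open>Small balls of the Riemannian distance\<close>

lemma riemannian_metricD:
  assumes "Ck_riemannian_metric k \<A> g" "c \<in> \<A>"
  shows "x \<in> chart_dom c \<Longrightarrow> bilinear (g c x)"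
    and "x \<in> chart_dom c \<Longrightarrow> v \<noteq> 0 \<Longrightarrow> 0 < g c x v v"
    and "d \<in> \<A> \<Longrightarrow> x \<in> chart_dom c \<inter> chart_dom d \<Longrightarrow>
      g c x v w = g d x (transition_deriv c d x v) (transition_deriv c d x w)"
    and "Ck_on k (coord c ` chart_dom c) (\<lambda>y. g c (chart_inv c y) v w)"
proof -
  note metric = assms(1)[unfolded Ck_riemannian_metric_def]
  note at_point = metric[THEN conjunct1, rule_format, OF assms(2)]
  show "x \<in> chart_dom c \<Longrightarrow> bilinear (g c x)"
    by (rule at_point[THEN conjunct1])
  show "x \<in> chart_dom c \<Longrightarrow> v \<noteq> 0 \<Longrightarrow> 0 < g c x v v"
    by (rule at_point[THEN conjunct2, THEN conjunct2, rule_format])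
  show "d \<in> \<A> \<Longrightarrow> x \<in> chart_dom c \<inter> chart_dom d \<Longrightarrow>
      g c x v w = g d x (transition_deriv c d x v) (transition_deriv c d x w)"
    by (rule metric[THEN conjunct2, THEN conjunct1, rule_format, OF assms(2)])
  show "Ck_on k (coord c ` chart_dom c) (\<lambda>y. g c (chart_inv c y) v w)"
    by (rule metric[THEN conjunct2, THEN conjunct2, rule_format, OF assms(2)])
qed

text \<open>By homogeneity it is enough to bound the metric below on unit vectors, and there it is a positive
  continuous function on a compact set.\<close>

lemma riemannian_metric_lower_bound:
  fixes \<A> :: "('a, 'e::euclidean_space) chart set"
  assumes "Ck_riemannian_metric k \<A> g" "c \<in> \<A>" "compact K" "K \<noteq> {}" "K \<subseteq> coord c ` chart_dom c"
  obtains \<alpha> where "0 < \<alpha>" "\<And>y v. y \<in> K \<Longrightarrow> \<alpha> * norm v \<le> sqrt (g c (chart_inv c y) v v)"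
proof -
  have dom: "chart_inv c y \<in> chart_dom c" if "y \<in> K" for y
    using that assms(5) by (auto intro: inv_into_into)
  have bil: "bilinear (g c (chart_inv c y))" if "y \<in> K" for y
    by (rule riemannian_metricD(1)[OF assms(1,2) dom[OF that]])
  have pos: "0 < g c (chart_inv c y) v v" if "y \<in> K" "v \<noteq> 0" for y v
    by (rule riemannian_metricD(2)[OF assms(1,2) dom[OF that(1)] that(2)])
  have cont: "continuous_on K (\<lambda>y. g c (chart_inv c y) v w)" for v w
    by (rule continuous_on_subset[OF Ck_on_imp_continuous_on[OF riemannian_metricD(4)[OF assms(1,2)]] assms(5)])
  have expand: "g c (chart_inv c y) v v =
      (\<Sum>(i, j)\<in>Basis \<times> Basis. (v \<bullet> i) * ((v \<bullet> j) * g c (chart_inv c y) i j))" if "y \<in> K" for y v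
  proof -
    have "g c (chart_inv c y) (\<Sum>i\<in>Basis. (v \<bullet> i) *\<^sub>R i) (\<Sum>j\<in>Basis. (v \<bullet> j) *\<^sub>R j) =
      (\<Sum>(i, j)\<in>Basis \<times> Basis. g c (chart_inv c y) ((v \<bullet> i) *\<^sub>R i) ((v \<bullet> j) *\<^sub>R j))"
      by (rule bilinear_sum[OF bil[OF that]])
    then show ?thesis
      by (simp add: euclidean_representation bilinear_lmul[OF bil[OF that]] bilinear_rmul[OF bil[OF that]]
          mult.left_commute)
  qed
  \<comment> \<open>The regularity of the metric concerns fixed vectors; joint continuity in point and vector comes
    from the expansion in the standard basis.\<close>
  have "continuous_on (K \<times> sphere 0 1)
      (\<lambda>z. \<Sum>(i, j)\<in>Basis \<times> Basis. (snd z \<bullet> i) * ((snd z \<bullet> j) * g c (chart_inv c (fst z)) i j))"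
    unfolding case_prod_beta
    by (intro continuous_intros continuous_on_compose2[OF cont]) auto
  then have cont2: "continuous_on (K \<times> sphere 0 1) (\<lambda>z. g c (chart_inv c (fst z)) (snd z) (snd z))"
    by (rule continuous_on_eq) (auto simp: expand)
  obtain u :: 'e where "norm u = 1"
    using vector_choose_size[of 1] by auto
  then have "K \<times> sphere (0::'e) 1 \<noteq> {}"
    using assms(4) by auto
  from continuous_attains_inf[OF _ this cont2] assms(3)
  obtain z where z: "z \<in> K \<times> sphere 0 1" and min:
    "\<And>z'. z' \<in> K \<times> sphere 0 1 \<Longrightarrow>
      g c (chart_inv c (fst z)) (snd z) (snd z) \<le> g c (chart_inv c (fst z')) (snd z') (snd z')"
    by (auto simp: compact_Times)
  define \<beta> where "\<beta> = g c (chart_inv c (fst z)) (snd z) (snd z)"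
  have \<beta>: "0 < \<beta>"
    unfolding \<beta>_def using z by (intro pos) auto
  show thesis
  proof (rule that[of "sqrt \<beta>"])
    show "0 < sqrt \<beta>" using \<beta> by simp
    fix y and v :: 'e
    assume y: "y \<in> K"
    show "sqrt \<beta> * norm v \<le> sqrt (g c (chart_inv c y) v v)"
    proof (cases "v = 0")
      case True
      then show ?thesis
        by (simp add: bilinear_lzero[OF bil[OF y]])
    next
      case False
      then have "\<beta> \<le> g c (chart_inv c y) (v /\<^sub>R norm v) (v /\<^sub>R norm v)"
        using min[of "(y, v /\<^sub>R norm v)"] y by (simp add: \<beta>_def)
      also have "\<dots> = g c (chart_inv c y) v v / (norm v)\<^sup>2"
        by (simp add: bilinear_lmul[OF bil[OF y]] bilinear_rmul[OF bil[OF y]] power2_eq_square field_simps)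
      finally have "\<beta> * (norm v)\<^sup>2 \<le> g c (chart_inv c y) v v"
        using False by (simp add: field_simps)
      then have "sqrt (\<beta> * (norm v)\<^sup>2) \<le> sqrt (g c (chart_inv c y) v v)"
        by (rule real_sqrt_le_mono)
      then show ?thesis
        by (simp add: real_sqrt_mult)
    qed
  qed
qed

text \<open>The chart selected in the definition of the speed may differ from \<open>c\<close>. The chain rule carries the
  velocity from one chart to the other by \<open>transition_deriv\<close>, under which the metric is invariant.\<close>

lemma curve_speed_in_chart:
  fixes \<A> :: "('a::topological_space, 'e::euclidean_space) chart set"
  assumes "Ck_atlas m \<A>" "1 \<le> m" "Ck_riemannian_metric k \<A> g" "c \<in> \<A>"
    and t: "t \<in> {0<..<1}" "\<gamma> t \<in> chart_dom c" "isCont \<gamma> t"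
    and deriv: "((coord c \<circ> \<gamma>) has_vector_derivative w) (at t)"
  shows "curve_speed \<A> g \<gamma> t = sqrt (g c (\<gamma> t) w w)"
proof -
  define d where "d = (SOME d. d \<in> \<A> \<and> \<gamma> t \<in> chart_dom d)"
  have "d \<in> \<A> \<and> \<gamma> t \<in> chart_dom d"
    unfolding d_def by (rule someI[of _ c]) (use assms in auto)
  then have d: "d \<in> \<A>" "\<gamma> t \<in> chart_dom d" by auto
  define T where "T = coord d \<circ> chart_inv c"
  obtain m' where "m = Suc m'" using assms(2) by (cases m) auto
  then have "T differentiable (at (coord c (\<gamma> t)))"
    using assms(1,4) d t(2) unfolding Ck_atlas_def T_def by fastforce
  then have T: "(T has_derivative transition_deriv c d (\<gamma> t)) (at (coord c (\<gamma> t)))"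
    unfolding transition_deriv_def T_def[symmetric] by (simp add: frechet_derivative_works)
  have "(T \<circ> (coord c \<circ> \<gamma>) has_derivative (transition_deriv c d (\<gamma> t) \<circ> (\<lambda>h. h *\<^sub>R w))) (at t)"
    using deriv T by (intro diff_chain_at) (auto simp: has_vector_derivative_def)
  moreover have "transition_deriv c d (\<gamma> t) \<circ> (\<lambda>h. h *\<^sub>R w) = (\<lambda>h. h *\<^sub>R transition_deriv c d (\<gamma> t) w)"
    using linear_scale[OF has_derivative_linear[OF T]] by auto
  ultimately have 1: "(T \<circ> (coord c \<circ> \<gamma>) has_vector_derivative transition_deriv c d (\<gamma> t) w) (at t)"
    by (simp add: has_vector_derivative_def)
  have "(\<gamma> \<longlongrightarrow> \<gamma> t) (nhds t)"
    using t(3) by (simp add: continuous_at tendsto_at_iff_tendsto_nhds)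
  then have "\<forall>\<^sub>F s in nhds t. \<gamma> s \<in> chart_dom c"
    using atlas_chart(1)[OF assms(1,4)] t(2) by (rule topological_tendstoD)
  then have ev: "\<forall>\<^sub>F s in nhds t. s \<in> UNIV \<longrightarrow> (T \<circ> (coord c \<circ> \<gamma>)) s = (coord d \<circ> \<gamma>) s"
    by eventually_elim (simp add: T_def chart_inv_coord[OF assms(1,4)])
  have "((coord d \<circ> \<gamma>) has_vector_derivative transition_deriv c d (\<gamma> t) w) (at t)"
    using 1 has_vector_derivative_cong_ev[OF ev] eventually_nhds_x_imp_x[OF ev] by blast
  moreover have "at t within {0..1} = at t"
    using t(1) by (simp add: at_within_Icc_at)
  ultimately have "vector_derivative (coord d \<circ> \<gamma>) (at t within {0..1}) = transition_deriv c d (\<gamma> t) w"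
    by (simp add: vector_derivative_at)
  then have "curve_speed \<A> g \<gamma> t =
      sqrt (g d (\<gamma> t) (transition_deriv c d (\<gamma> t) w) (transition_deriv c d (\<gamma> t) w))"
    by (simp add: curve_speed_def d_def[symmetric] Let_def)
  also have "\<dots> = sqrt (g c (\<gamma> t) w w)"
    using riemannian_metricD(3)[OF assms(3,4) d(1), of "\<gamma> t" w w] d(2) t(2) by simp
  finally show ?thesis .
qed

lemma dist_le_nn_integral_norm_derivative:
  fixes q :: "real \<Rightarrow> 'e::euclidean_space"
  assumes "a \<le> b" "continuous_on {a..b} D"
    and "\<And>t. t \<in> {a..b} \<Longrightarrow> (q has_vector_derivative D t) (at t within {a..b})"
  shows "ennreal (norm (q b - q a)) \<le> (\<integral>\<^sup>+t. ennreal (indicator {a<..<b} t * norm (D t)) \<partial>lborel)"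
proof -
  have int_norm: "(\<lambda>t. norm (D t)) integrable_on {a..b}"
    using assms(2) by (intro integrable_continuous_interval continuous_on_norm)
  have D: "(D has_integral (q b - q a)) {a..b}"
    using assms by (intro fundamental_theorem_of_calculus) auto
  then have "norm (integral {a..b} D) \<le> integral {a..b} (\<lambda>t. norm (D t))"
    using int_norm
    by (intro Henstock_Kurzweil_Integration.integral_norm_bound_integral) (auto simp: has_integral_integrable)
  then have "norm (q b - q a) \<le> integral {a..b} (\<lambda>t. norm (D t))"
    using integral_unique[OF D] by simp
  moreover have "((\<lambda>t. norm (D t)) has_integral integral {a..b} (\<lambda>t. norm (D t))) {a<..<b}"
    using int_norm by (intro has_integral_Icc_iff_Ioo[THEN iffD1] integrable_integral)
  then have "(\<integral>\<^sup>+t. ennreal (indicator {a<..<b} t * norm (D t)) \<partial>lborel) =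
      ennreal (integral {a..b} (\<lambda>t. norm (D t)))"
    by (intro nn_integral_has_integral_lebesgue) auto
  ultimately show ?thesis
    by (simp add: ennreal_leI)
qed

text \<open>On each piece the speed dominates \<open>\<alpha>\<close> times the euclidean speed of the image \<open>q\<close> of the curve in
  the chart, whose integral dominates the displacement of \<open>q\<close>. The pieces are combined by induction. The
  speed is defined with a chart chosen anew at every point and with junk values at the break points;
  collecting a minorant \<open>h\<close> of it that is measurable by construction avoids an argument for the
  measurability of the speed itself.\<close>

lemma curve_length_ge_in_chart:
  fixes \<A> :: "('a::topological_space, 'e::euclidean_space) chart set"
  assumes "Ck_atlas m \<A>" "1 \<le> m" "Ck_riemannian_metric k \<A> g" "c \<in> \<A>"
    and "0 \<le> \<alpha>"
    and bound: "\<And>y v. y \<in> K \<Longrightarrow> \<alpha> * norm v \<le> sqrt (g c (chart_inv c y) v v)"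
    and \<gamma>: "piecewise_C1_curve \<A> \<gamma>" "0 \<le> b" "b \<le> 1"
    and inside: "\<And>t. t \<in> {0..b} \<Longrightarrow> \<gamma> t \<in> chart_dom c \<and> coord c (\<gamma> t) \<in> K"
  shows "ennreal (\<alpha> * norm (coord c (\<gamma> b) - coord c (\<gamma> 0))) \<le> curve_length \<A> g \<gamma>"
proof -
  obtain n p where p: "p 0 = 0" "p n = 1"
    "\<And>i. i < n \<Longrightarrow> p i < p (Suc i)" "\<And>i. i < n \<Longrightarrow> C1_curve_on \<A> (p i) (p (Suc i)) \<gamma>"
    using \<gamma>(1) by (auto simp: piecewise_C1_curve_def)
  define q where "q = coord c \<circ> \<gamma>"
  \<comment> \<open>The minorant vanishes at and after \<open>p i\<close>, so adding the contribution of the next open piece keeps it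
    below the speed. The curve is only followed up to time \<open>b\<close>, whence \<open>min (p i) b\<close>.\<close>
  have "\<exists>h\<in>borel_measurable lborel. (\<forall>t. h t \<le> ennreal (curve_speed \<A> g \<gamma> t) * indicator {0..<p i} t) \<and>
      ennreal (\<alpha> * norm (q (min (p i) b) - q 0)) \<le> integral\<^sup>N lborel h \<and> 0 \<le> p i" if "i \<le> n" for i
    using that
  proof (induction i)
    case 0
    show ?case
      using p(1) \<gamma>(2) by (intro bexI[of _ "\<lambda>_. 0"]) auto
  next
    case (Suc i)
    then obtain h where h: "h \<in> borel_measurable lborel"
      "\<And>t. h t \<le> ennreal (curve_speed \<A> g \<gamma> t) * indicator {0..<p i} t"
      "ennreal (\<alpha> * norm (q (min (p i) b) - q 0)) \<le> integral\<^sup>N lborel h" "0 \<le> p i"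
      by auto
    have step: "p i < p (Suc i)" and C1: "C1_curve_on \<A> (p i) (p (Suc i)) \<gamma>"
      using p(3,4) Suc.prems by auto
    show ?case
    proof (cases "b \<le> p i")
      case True
      have "h t \<le> ennreal (curve_speed \<A> g \<gamma> t) * indicator {0..<p (Suc i)} t" for t
        using step by (intro order_trans[OF h(2)[of t]] mult_left_mono) (auto simp: indicator_def)
      moreover have "min (p i) b = b" "min (p (Suc i)) b = b"
        using True step by auto
      ultimately show ?thesis
        using h step by (intro bexI[of _ h]) auto
    next
      case False
      define a b' where "a = p i" and "b' = min (p (Suc i)) b"
      have ab: "0 \<le> a" "a < b'" "b' \<le> 1" "b' \<le> b" "b' \<le> p (Suc i)"
        using False step h(4) \<gamma> by (auto simp: a_def b'_def)
      obtain D where D: "continuous_on {t\<in>{p i..p (Suc i)}. \<gamma> t \<in> chart_dom c} D"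
        "\<And>t. t \<in> {p i..p (Suc i)} \<Longrightarrow> \<gamma> t \<in> chart_dom c \<Longrightarrow>
           (q has_vector_derivative D t) (at t within {p i..p (Suc i)})"
        using C1[unfolded C1_curve_on_def, THEN conjunct2, rule_format, OF assms(4)]
        unfolding q_def by blast
      have piece: "t \<in> {p i..p (Suc i)}" "\<gamma> t \<in> chart_dom c" "coord c (\<gamma> t) \<in> K"
        if "t \<in> {a..b'}" for t
        using that ab inside[of t] by (simp_all add: a_def)
      have contD: "continuous_on {a..b'} D"
        using D(1) by (rule continuous_on_subset) (blast intro: piece)
      have derivD: "(q has_vector_derivative D t) (at t within {a..b'})" if "t \<in> {a..b'}" for t
        by (rule has_vector_derivative_within_subset[OF D(2)[OF piece(1,2)[OF that]]]) (rule subsetI, rule piece(1))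
      define e where "e t = ennreal (indicator {a<..<b'} t * norm (D t))" for t
      define h' where "h' t = ennreal \<alpha> * e t" for t
      have "(\<lambda>t. indicator {a<..<b'} t * norm (D t)) \<in> borel_measurable borel"
        using borel_measurable_continuous_on_indicator[of "{a<..<b'}" "\<lambda>t. norm (D t)"]
          continuous_on_subset[OF contD, of "{a<..<b'}"]
        by (simp add: continuous_on_norm subset_iff)
      then have e_meas: "e \<in> borel_measurable lborel"
        using measurable_compose[OF _ measurable_ennreal] by (simp add: e_def[abs_def])
      then have h'_meas: "h' \<in> borel_measurable lborel"
        by (simp add: h'_def[abs_def])
      have "ennreal (norm (q b' - q a)) \<le> integral\<^sup>N lborel e"
        unfolding e_def by (rule dist_le_nn_integral_norm_derivative[OF less_imp_le[OF ab(2)] contD derivD])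
      then have "ennreal \<alpha> * ennreal (norm (q b' - q a)) \<le> integral\<^sup>N lborel h'"
        unfolding h'_def nn_integral_cmult[OF e_meas] by (rule mult_left_mono) simp
      then have h'_int: "ennreal (\<alpha> * norm (q b' - q a)) \<le> integral\<^sup>N lborel h'"
        using \<open>0 \<le> \<alpha>\<close> by (simp only: ennreal_mult norm_ge_zero)
      have h'_le: "h' t \<le> ennreal (curve_speed \<A> g \<gamma> t) * indicator {a<..<b'} t" for t
      proof (cases "t \<in> {a<..<b'}")
        case True
        then have t: "t \<in> {a..b'}" "t \<in> {0<..<1}"
          using ab by auto
        have interior: "at t within {p i..p (Suc i)} = at t"
          using True ab by (simp add: at_within_Icc_at a_def)
        have "continuous (at t within {p i..p (Suc i)}) \<gamma>"
          using C1[unfolded C1_curve_on_def, THEN conjunct1] piece(1)[OF t(1)]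
          by (simp add: continuous_on_eq_continuous_within)
        then have "isCont \<gamma> t"
          by (simp only: interior)
        moreover have "(q has_vector_derivative D t) (at t)"
          using D(2)[OF piece(1,2)[OF t(1)]] by (simp only: interior)
        ultimately have "curve_speed \<A> g \<gamma> t = sqrt (g c (\<gamma> t) (D t) (D t))"
          unfolding q_def using t(2) piece(2)[OF t(1)] by (intro curve_speed_in_chart[OF assms(1-4)])
        moreover have "\<alpha> * norm (D t) \<le> sqrt (g c (\<gamma> t) (D t) (D t))"
          using bound[OF piece(3)[OF t(1)], of "D t"] chart_inv_coord[OF assms(1,4) piece(2)[OF t(1)]] by simp
        ultimately show ?thesis
          using True \<open>0 \<le> \<alpha>\<close> by (simp add: h'_def e_def ennreal_mult[symmetric] ennreal_leI)
      qed (simp add: h'_def e_def)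
      show ?thesis
      proof (intro bexI[of _ "\<lambda>t. h t + h' t"] conjI allI)
        fix t
        show "h t + h' t \<le> ennreal (curve_speed \<A> g \<gamma> t) * indicator {0..<p (Suc i)} t"
          using h(2)[of t] h'_le[of t] step ab
          by (cases "t < a"; cases "t \<in> {a<..<b'}"; cases "t \<in> {0..<p (Suc i)}") (simp_all add: a_def)
      next
        have "norm (q b' - q 0) \<le> norm (q a - q 0) + norm (q b' - q a)"
          using norm_triangle_ineq[of "q a - q 0" "q b' - q a"] by simp
        then have "ennreal (\<alpha> * norm (q b' - q 0)) \<le>
            ennreal (\<alpha> * norm (q a - q 0)) + ennreal (\<alpha> * norm (q b' - q a))"
          using \<open>0 \<le> \<alpha>\<close>
          by (simp add: ennreal_plus[symmetric] ennreal_leI mult_left_mono distrib_left[symmetric]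
              del: ennreal_plus)
        also have "\<dots> \<le> integral\<^sup>N lborel h + integral\<^sup>N lborel h'"
          using h(3) h'_int False by (intro add_mono) (simp_all add: a_def min_def)
        also have "\<dots> = (\<integral>\<^sup>+t. h t + h' t \<partial>lborel)"
          using h(1) h'_meas by (simp add: nn_integral_add)
        finally show "ennreal (\<alpha> * norm (q (min (p (Suc i)) b) - q 0)) \<le> (\<integral>\<^sup>+t. h t + h' t \<partial>lborel)"
          by (simp add: b'_def)
      qed (use h step h'_meas in auto)
    qed
  qed
  from this[of n] obtain h where
    "\<And>t. h t \<le> ennreal (curve_speed \<A> g \<gamma> t) * indicator {0..<1} t"
    and le: "ennreal (\<alpha> * norm (q b - q 0)) \<le> integral\<^sup>N lborel h"
    using p(2) \<gamma>(3) by (auto simp: min_def)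
  from this(1) have "h t \<le> ennreal (curve_speed \<A> g \<gamma> t) * indicator {0..1} t" for t
    by (rule order_trans) (auto simp: indicator_def)
  then have "integral\<^sup>N lborel h \<le> curve_length \<A> g \<gamma>"
    unfolding curve_length_def by (intro nn_integral_mono)
  with le show ?thesis
    by (simp add: q_def)
qed

lemma piecewise_C1_curve_continuous:
  assumes "piecewise_C1_curve \<A> \<gamma>"
  shows "continuous_on {0..1} \<gamma>"
proof -
  obtain n p where p: "p 0 = 0" "p n = (1::real)"
    "\<And>i. i < n \<Longrightarrow> p i < p (Suc i)" "\<And>i. i < n \<Longrightarrow> C1_curve_on \<A> (p i) (p (Suc i)) \<gamma>"
    using assms by (auto simp: piecewise_C1_curve_def)
  have "continuous_on {0..p i} \<gamma> \<and> 0 \<le> p i" if "i \<le> n" for i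
    using that
  proof (induction i)
    case (Suc i)
    have "continuous_on ({0..p i} \<union> {p i..p (Suc i)}) \<gamma>"
      using Suc p by (intro continuous_on_closed_Un) (auto simp: C1_curve_on_def)
    moreover have "{0..p i} \<union> {p i..p (Suc i)} = {0..p (Suc i)}"
      using Suc p(3)[of i] by auto
    ultimately show ?case
      using Suc p(3)[of i] by auto
  qed (simp add: p(1))
  from this[of n] show ?thesis by (simp add: p(2))
qed

text \<open>The topology of \<open>\<rho>\<close> is finer than that of the manifold: a curve from \<open>x\<close> that leaves \<open>U\<close> first has
  to cross a coordinate ball of some radius \<open>\<delta>\<close> around \<open>x\<close>, on which the metric dominates the
  euclidean one with a factor \<open>\<alpha>\<close>, so its length is at least \<open>\<alpha> * \<delta>\<close>.\<close>

lemma small_dist_ball_subset: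
  fixes \<A> :: "('a::t2_space, 'e::euclidean_space) chart set"
  assumes "Ck_atlas m \<A>" "1 \<le> m" "Ck_riemannian_metric k \<A> g" "open U" "x \<in> U"
  obtains \<epsilon> where "0 < \<epsilon>" "dist_ball (riemannian_dist \<A> g) x \<epsilon> \<subseteq> U"
proof -
  obtain c where c: "c \<in> \<A>" "x \<in> chart_dom c"
    using atlas_cover[OF assms(1)] .
  note hom = atlas_chart(3)[OF assms(1) c(1)]
  have "openin (top_of_set (coord c ` chart_dom c)) (coord c ` (chart_dom c \<inter> U))"
    using homeomorphism_imp_open_map[OF hom] assms(4) by (simp add: openin_open_Int)
  then have "open (coord c ` (chart_dom c \<inter> U))"
    using atlas_chart(2)[OF assms(1) c(1)] openin_open_trans by blast
  then obtain \<delta> where \<delta>: "0 < \<delta>" "cball (coord c x) \<delta> \<subseteq> coord c ` (chart_dom c \<inter> U)"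
    using c assms(5) open_contains_cball[of "coord c ` (chart_dom c \<inter> U)"] by blast
  define K where "K = cball (coord c x) \<delta>"
  have K_sub: "K \<subseteq> coord c ` chart_dom c"
    using \<delta>(2) by (auto simp: K_def)
  obtain \<alpha> where \<alpha>: "0 < \<alpha>" "\<And>y v. y \<in> K \<Longrightarrow> \<alpha> * norm v \<le> sqrt (g c (chart_inv c y) v v)"
    using riemannian_metric_lower_bound[OF assms(3) c(1) _ _ K_sub] \<delta>(1) by (auto simp: K_def)
  define W where "W = chart_inv c ` ball (coord c x) \<delta>"
  define C where "C = chart_inv c ` K"
  have contI: "continuous_on K (chart_inv c)"
    using hom K_sub by (auto simp: homeomorphism_def intro: continuous_on_subset)
  have "closed C"
    unfolding C_def using contI by (intro compact_imp_closed compact_continuous_image) (auto simp: K_def)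
  have C_sub: "C \<subseteq> chart_dom c \<inter> U"
  proof
    fix z assume "z \<in> C"
    then obtain y where "y \<in> K" "z = chart_inv c y" by (auto simp: C_def)
    then obtain z' where "z' \<in> chart_dom c \<inter> U" "y = coord c z'"
      using \<delta>(2) by (auto simp: K_def)
    then show "z \<in> chart_dom c \<inter> U"
      using chart_inv_coord[OF assms(1) c(1)] \<open>z = chart_inv c y\<close> by auto
  qed
  have W_sub: "W \<subseteq> C"
    by (auto simp: W_def C_def K_def)
  have coordC: "coord c z \<in> K" if "z \<in> C" for z
    using that K_sub homeomorphism_apply2[OF hom] by (auto simp: C_def)
  have coordW: "z \<in> W" if "z \<in> C" "dist (coord c x) (coord c z) < \<delta>" for z
    using that C_sub chart_inv_coord[OF assms(1) c(1), of z] unfolding W_def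
    by (intro image_eqI[of z _ "coord c z"]) auto
  have "openin (top_of_set (chart_dom c)) W"
    unfolding W_def using K_sub
    by (intro homeomorphism_imp_open_map[OF homeomorphism_symD[OF hom]] open_openin_trans)
       (auto simp: K_def atlas_chart[OF assms(1) c(1)])
  then have "open W"
    using atlas_chart(1)[OF assms(1) c(1)] openin_open_trans by blast
  have "x \<in> W"
    unfolding W_def using \<delta>(1) chart_inv_coord[OF assms(1) c]
    by (intro image_eqI[of x _ "coord c x"]) auto
  have long: "ennreal (\<alpha> * \<delta>) \<le> curve_length \<A> g \<gamma>"
    if \<gamma>: "piecewise_C1_curve \<A> \<gamma>" "\<gamma> 0 = x" "\<gamma> 1 \<notin> U" for \<gamma>
  proof -
    note cont = piecewise_C1_curve_continuous[OF \<gamma>(1)]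
    \<comment> \<open>The minimum \<open>b\<close> of \<open>S\<close> is the first exit time from the open coordinate ball \<open>W\<close>: until then the
      curve stays in the compact ball \<open>C\<close>, and at time \<open>b\<close> it has distance at least \<open>\<delta>\<close> from \<open>x\<close> in the
      chart.\<close>
    define S where "S = {0..1} \<inter> \<gamma> -` (- W)"
    have "closed S"
      unfolding S_def using cont \<open>open W\<close> by (intro continuous_closed_preimage) auto
    moreover have "1 \<in> S"
      using \<gamma>(3) W_sub C_sub by (auto simp: S_def)
    moreover have "bounded S"
      by (rule bounded_subset[of "{0..1}"]) (auto simp: S_def)
    ultimately obtain b where b: "b \<in> S" "\<And>t. t \<in> S \<Longrightarrow> b \<le> t"
      using compact_attains_inf[of S] compact_eq_bounded_closed by blast
    then have b01: "0 \<le> b" "b \<le> 1" "\<gamma> b \<notin> W"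
      by (auto simp: S_def)
    have inW: "\<gamma> t \<in> W" if "0 \<le> t" "t < b" for t
      using b(2)[of t] that b01 by (auto simp: S_def)
    have "b \<noteq> 0"
      using b01 \<gamma>(2) \<open>x \<in> W\<close> by auto
    \<comment> \<open>The exit point itself lies in \<open>C\<close> because \<open>C\<close> is closed and contains the curve before time \<open>b\<close>.\<close>
    have inC: "\<gamma> t \<in> C" if "t \<in> {0..b}" for t
    proof -
      have "closed ({0..b} \<inter> \<gamma> -` C)"
        using cont \<open>closed C\<close> b01
        by (intro continuous_closed_preimage) (auto intro: continuous_on_subset)
      moreover have "{0<..<b} \<subseteq> {0..b} \<inter> \<gamma> -` C"
        using inW W_sub by fastforce
      ultimately have "closure {0<..<b} \<subseteq> {0..b} \<inter> \<gamma> -` C"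
        by (rule closure_minimal[rotated])
      then show ?thesis
        using that b01 \<open>b \<noteq> 0\<close> by auto
    qed
    then have "\<delta> \<le> dist (coord c x) (coord c (\<gamma> b))"
      using coordW[of "\<gamma> b"] b01 by fastforce
    then have "\<alpha> * \<delta> \<le> \<alpha> * norm (coord c (\<gamma> b) - coord c (\<gamma> 0))"
      using \<alpha>(1) \<gamma>(2) by (simp add: dist_norm norm_minus_commute)
    then have "ennreal (\<alpha> * \<delta>) \<le> ennreal (\<alpha> * norm (coord c (\<gamma> b) - coord c (\<gamma> 0)))"
      by (rule ennreal_leI)
    also have "\<dots> \<le> curve_length \<A> g \<gamma>"
      using inC C_sub coordC \<alpha> b01
      by (intro curve_length_ge_in_chart[OF assms(1-3) c(1) _ _ \<gamma>(1), of \<alpha> K]) auto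
    finally show ?thesis .
  qed
  have "dist_ball (riemannian_dist \<A> g) x (\<alpha> * \<delta>) \<subseteq> U"
  proof
    fix z assume "z \<in> dist_ball (riemannian_dist \<A> g) x (\<alpha> * \<delta>)"
    then obtain \<gamma> where "piecewise_C1_curve \<A> \<gamma>" "\<gamma> 0 = x" "\<gamma> 1 = z"
      "curve_length \<A> g \<gamma> < ennreal (\<alpha> * \<delta>)"
      by (auto simp: dist_ball_def riemannian_dist_def Inf_less_iff)
    then show "z \<in> U"
      using long[of \<gamma>] by (auto simp: not_le[symmetric])
  qed
  then show thesis
    using that[of "\<alpha> * \<delta>"] \<alpha>(1) \<delta>(1) by simp
qed

section \<open>The measures with density \<open>r\<close>\<close>

text \<open>Near a point \<open>x\<close> the continuous function \<open>r\<close> lies between \<open>r x / 2\<close> and \<open>2 * r x\<close>. Sets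
  that are not measurable satisfy the inequalities because both measures give them the value \<open>0\<close>.\<close>

lemma mu_hat_locally_comparable:
  fixes \<mu> :: "'a::topological_space measure"
  assumes "sets \<mu> = sets borel" "open W" "continuous_on W r" "x \<in> W" "0 < r x"
  obtains V where "open V" "x \<in> V"
    "\<And>B. B \<subseteq> V \<Longrightarrow> emeasure (mu_hat W r \<mu>) B \<le> ennreal (2 * r x) * emeasure \<mu> B"
    "\<And>B. B \<subseteq> V \<Longrightarrow> emeasure \<mu> B \<le> ennreal (2 / r x) * emeasure (mu_hat W r \<mu>) B"
proof -
  define V where "V = r -` {r x / 2 <..< 2 * r x} \<inter> W"
  have V: "open V" "x \<in> V"
    using assms by (auto simp: V_def continuous_on_open_vimage)
  have "(\<lambda>y. indicator W y *\<^sub>R r y) \<in> borel_measurable borel"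
    using assms by (intro borel_measurable_continuous_on_indicator) auto
  then have "(\<lambda>y. ennreal (indicator W y *\<^sub>R r y)) \<in> borel_measurable \<mu>"
    using assms(1) by (simp cong: measurable_cong_sets)
  also have "(\<lambda>y. ennreal (indicator W y *\<^sub>R r y)) = (\<lambda>y. ennreal (r y) * indicator W y)"
    by (auto simp: indicator_def)
  finally have meas: "(\<lambda>y. ennreal (r y) * indicator W y) \<in> borel_measurable \<mu>" .
  have sets: "sets (mu_hat W r \<mu>) = sets \<mu>"
    by (simp add: mu_hat_def)
  have upper: "emeasure (mu_hat W r \<mu>) B \<le> ennreal (2 * r x) * emeasure \<mu> B" if "B \<subseteq> V" for B
  proof (cases "B \<in> sets \<mu>")
    case True
    have "emeasure (mu_hat W r \<mu>) B = (\<integral>\<^sup>+y. ennreal (r y) * indicator W y * indicator B y \<partial>\<mu>)"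
      using True meas by (simp add: mu_hat_def emeasure_density)
    also have "\<dots> \<le> (\<integral>\<^sup>+y. ennreal (2 * r x) * indicator B y \<partial>\<mu>)"
      using that by (intro nn_integral_mono) (auto simp: indicator_def V_def intro!: ennreal_leI)
    also have "\<dots> = ennreal (2 * r x) * emeasure \<mu> B"
      using True by (simp add: nn_integral_cmult_indicator)
    finally show ?thesis .
  next
    case False
    then show ?thesis using sets by (simp add: emeasure_notin_sets)
  qed
  have lower: "emeasure \<mu> B \<le> ennreal (2 / r x) * emeasure (mu_hat W r \<mu>) B" if "B \<subseteq> V" for B
  proof (cases "B \<in> sets \<mu>")
    case True
    have "emeasure \<mu> B = (\<integral>\<^sup>+y. indicator B y \<partial>\<mu>)"
      using True by simp
    also have "\<dots> \<le> (\<integral>\<^sup>+y. ennreal (2 / r x) * (ennreal (r y) * indicator W y * indicator B y) \<partial>\<mu>)"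
    proof (intro nn_integral_mono)
      fix y
      show "indicator B y \<le> ennreal (2 / r x) * (ennreal (r y) * indicator W y * indicator B y)"
      proof (cases "y \<in> B")
        case True
        then have "y \<in> W" "1 \<le> 2 / r x * r y" "0 \<le> r y"
          using that assms(5) by (auto simp: V_def field_simps)
        then have "1 \<le> ennreal (2 / r x) * ennreal (r y)"
          using assms(5) by (simp add: ennreal_mult[symmetric] del: times_divide_eq_left)
        then show ?thesis
          using True \<open>y \<in> W\<close> by simp
      qed simp
    qed
    also have "\<dots> = ennreal (2 / r x) * emeasure (mu_hat W r \<mu>) B"
      using True meas by (simp add: mu_hat_def emeasure_density nn_integral_cmult)
    finally show ?thesis .
  next
    case False
    then show ?thesis by (simp add: emeasure_notin_sets)
  qed
  show thesis
    using that V upper lower by blast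
qed

text \<open>A set of full measure for \<open>\<mu>\<close> has full measure for \<open>\<mu>\<^sub>r\<close>, so the infimum that defines the
  dimension of \<open>\<mu>\<^sub>r\<close> is over a larger family of sets.\<close>

lemma measure_hausdorff_dim_mu_rep_le:
  assumes "prob_space \<mu>" "integrable \<mu> r" "\<And>x. 0 \<le> r x" "0 < (LINT x|\<mu>. r x)"
  shows "measure_hausdorff_dim \<rho> (mu_rep r \<mu>) \<le> measure_hausdorff_dim \<rho> \<mu>"
proof -
  interpret prob_space \<mu> by fact
  define I where "I = (LINT x|\<mu>. r x)"
  have full: "emeasure (mu_rep r \<mu>) A = 1" if A: "A \<in> sets \<mu>" "emeasure \<mu> A = 1" for A
  proof -
    have "AE y in \<mu>. y \<in> A"
      using A by (simp add: AE_in_set_eq_1 emeasure_eq_measure)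
    then have "(\<integral>\<^sup>+y. ennreal (r y / I) * indicator A y \<partial>\<mu>) = (\<integral>\<^sup>+y. ennreal (r y / I) \<partial>\<mu>)"
      by (intro nn_integral_cong_AE) auto
    also have "\<dots> = ennreal (LINT y|\<mu>. r y / I)"
      using assms by (intro nn_integral_eq_integral) (auto simp: I_def)
    also have "\<dots> = 1"
      using assms(4) by (simp add: I_def)
    finally show ?thesis
      using A(1) assms(2) by (simp add: mu_rep_def I_def emeasure_density)
  qed
  have "sets (mu_rep r \<mu>) = sets \<mu>"
    by (simp add: mu_rep_def)
  then have "{hausdorff_dim \<rho> A |A. A \<in> sets \<mu> \<and> emeasure \<mu> A = 1} \<subseteq>
      {hausdorff_dim \<rho> A |A. A \<in> sets (mu_rep r \<mu>) \<and> emeasure (mu_rep r \<mu>) A = 1}"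
    using full by blast
  then show ?thesis
    unfolding measure_hausdorff_dim_def by (rule Inf_superset_mono)
qed

theorem theorem6:
  fixes \<A> :: "('a::{t2_space, second_countable_topology}, 'e::euclidean_space) chart set"
    and g :: "('a, 'e) chart \<Rightarrow> 'a \<Rightarrow> 'e \<Rightarrow> 'e \<Rightarrow> real"
    and f :: "('a, 'e) chart \<Rightarrow> 'a \<Rightarrow> 'e"
    and \<Phi> \<Phi>r :: "real \<Rightarrow> 'a \<Rightarrow> 'a"
    and r :: "'a \<Rightarrow> real"
    and \<mu> :: "'a measure"
    and m l :: nat
    and \<rho> :: "'a \<Rightarrow> 'a \<Rightarrow> ennreal"
  assumes "2 \<le> m"
    and "Ck_atlas m \<A>"
    and "Ck_riemannian_metric (m - 1) \<A> g"
    and "\<rho> = riemannian_dist \<A> g"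
    and "1 \<le> l" and "l < m"
    and "Ck_vector_field l \<A> f"
    and "Ck_flow l \<A> \<Phi>"
    and "generates_flow \<A> f \<Phi>"
    and "time_reparameterization l \<A> \<Phi> \<Phi>r"
    and "associated_function l \<A> \<Phi> \<Phi>r r"
    and "\<mu> \<in> invariant_measures \<Phi>"
  shows "(\<forall>x\<in>M_hat l \<A> f r.
            lower_pointwise_dim \<rho> (mu_hat (M_hat l \<A> f r) r \<mu>) x = lower_pointwise_dim \<rho> \<mu> x \<and>
            upper_pointwise_dim \<rho> (mu_hat (M_hat l \<A> f r) r \<mu>) x = upper_pointwise_dim \<rho> \<mu> x) \<and>
         (integrable \<mu> r \<and> 0 < (LINT x|\<mu>. r x) \<longrightarrow>
            measure_hausdorff_dim \<rho> (mu_rep r \<mu>) \<le> measure_hausdorff_dim \<rho> \<mu>)"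
proof (intro conjI ballI impI)
  note M = M_hat_properties[OF assms(2,7,8,9,11)]
  have \<mu>: "sets \<mu> = sets borel" "prob_space \<mu>"
    using assms(12) by (auto simp: invariant_measures_def)
  define \<nu> where "\<nu> = mu_hat (M_hat l \<A> f r) r \<mu>"
  fix x assume x: "x \<in> M_hat l \<A> f r"
  then have rx: "0 < r x" by (rule M(3))
  obtain V where V: "open V" "x \<in> V"
    and comparable: "\<And>B. B \<subseteq> V \<Longrightarrow> emeasure \<nu> B \<le> ennreal (2 * r x) * emeasure \<mu> B"
      "\<And>B. B \<subseteq> V \<Longrightarrow> emeasure \<mu> B \<le> ennreal (2 / r x) * emeasure \<nu> B"
    using mu_hat_locally_comparable[OF \<mu>(1) M(1,2) x rx] unfolding \<nu>_def by blast
  obtain \<epsilon>\<^sub>0 where \<epsilon>\<^sub>0: "0 < \<epsilon>\<^sub>0" "dist_ball \<rho> x \<epsilon>\<^sub>0 \<subseteq> V"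
    using small_dist_ball_subset[OF assms(2) _ assms(3) V] assms(1,4) by auto
  have "\<forall>\<^sub>F \<epsilon> in at_right 0. dist_ball \<rho> x \<epsilon> \<subseteq> V"
    using eventually_at_right_real[OF \<epsilon>\<^sub>0(1)]
  proof eventually_elim
    case (elim \<epsilon>)
    then have "ennreal \<epsilon> \<le> ennreal \<epsilon>\<^sub>0" by (intro ennreal_leI) auto
    then show ?case
      using \<epsilon>\<^sub>0(2) by (auto simp: dist_ball_def subset_iff dest: order.strict_trans2)
  qed
  then have "\<forall>\<^sub>F \<epsilon> in at_right 0.
        emeasure \<nu> (dist_ball \<rho> x \<epsilon>) \<le> ennreal (2 * r x) * emeasure \<mu> (dist_ball \<rho> x \<epsilon>)"
    and "\<forall>\<^sub>F \<epsilon> in at_right 0.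
        emeasure \<mu> (dist_ball \<rho> x \<epsilon>) \<le> ennreal (2 / r x) * emeasure \<nu> (dist_ball \<rho> x \<epsilon>)"
    by (auto elim!: eventually_mono intro: comparable)
  note dims = pointwise_dim_antimono[OF _ this(1)] pointwise_dim_antimono[OF _ this(2)]
  show "lower_pointwise_dim \<rho> (mu_hat (M_hat l \<A> f r) r \<mu>) x = lower_pointwise_dim \<rho> \<mu> x"
    and "upper_pointwise_dim \<rho> (mu_hat (M_hat l \<A> f r) r \<mu>) x = upper_pointwise_dim \<rho> \<mu> x"
    using dims rx unfolding \<nu>_def[symmetric] by (auto intro: antisym)
next
  assume "integrable \<mu> r \<and> 0 < (LINT x|\<mu>. r x)"
  then show "measure_hausdorff_dim \<rho> (mu_rep r \<mu>) \<le> measure_hausdorff_dim \<rho> \<mu>"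
    using assms(11,12)
    by (intro measure_hausdorff_dim_mu_rep_le) (auto simp: associated_function_def invariant_measures_def)
qed

end
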